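(* Let $H$ be a Hilbert space and $T \colon H \to H$ be unitary, let $F\subseteq H$ be a finite-dimensional linear subspace and let $\varepsilon > 0$. For $n\in\mathbb{N}$ let $F_n := \operatorname{span}\bigcup_{k=0}^n T^k F$. Then there exist $K_0 \in \mathbb{N}$ and $\delta > 0$ such that whenever $n \in \mathbb{N}$, $K \geq K_0$ and $\hat T_n \colon F_n \to F_n$ is a linear operator with $$\lVert \hat T_n^k x - T^k x \rVert \leq \delta \lVert x \rVert \quad\text{for all } x \in F_n \text{ and all } k \in \{0, \dots, K - 1\},$$ then $$\dim(F_n) \geq K \bigl(h_{\mathrm{apr}}(T, F) - \varepsilon\bigr).$$
   Context: Hilbert spaces are over $\mathbb{K}\in\{\mathbb{R},\mathbb{C}\}$. Here $\mathbb{N}$ (as the range of $n$) includes $0$, with $F_0=F$. Approximation entropy. Let $H$ be a Hilbert space and $T\colon H\to H$ unitary. For a finite set $\omega\subseteq H$ and $\delta>0$ let $H_{\mathrm{apr}}(\omega,\delta)$ be the minimum of $\dim E$ over all finite-dimensional subspaces $E\subseteq H$ such that for every $x\in\omega$ there is $y\in E$ with $\lVert x-y\rVert<\delta$. Put $h_{\mathrm{apr}}(T,\omega,\delta):=\lim_{n\to\infty}\frac1n H_{\mathrm{apr}}\bigl(\bigcup_{k=0}^{n-1}T^k\omega,\delta\bigr)$ (the limit exists) and $h_{\mathrm{apr}}(T,\omega):=\sup_{\delta>0}h_{\mathrm{apr}}(T,\omega,\delta)$. For a closed linear subspace $F\subseteq H$ (not necessarily $T$-invariant), $h_{\mathrm{apr}}(T,F):=\sup\{h_{\mathrm{apr}}(T,\omega):\omega\subseteq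 F\text{ finite}\}$. *)

theory Defs
  imports "HOL-Analysis.Analysis"
begin

text \<open>
  The scalar field is the field of real or of complex numbers: a field together with an embedding
  into the complex numbers whose image is either the set of real numbers or everything.
  (The embedding is injective, being a ring homomorphism between fields.)
\<close>

class real_or_complex_field = real_field +
  fixes to_complex :: "'a \<Rightarrow> complex"
  assumes to_complex_add: "to_complex (a + b) = to_complex a + to_complex b"
    and to_complex_mult: "to_complex (a * b) = to_complex a * to_complex b"
    and to_complex_one: "to_complex 1 = 1"
    and to_complex_scaleR: "to_complex (r *\<^sub>R a) = r *\<^sub>R to_complex a"
    and range_to_complex: "range to_complex = \<real> \<or> range to_complex = UNIV"

instantiation real :: real_or_complex_field
begin

definition to_complex_real :: "real \<Rightarrow> complex" where
  "to_complex_real = complex_of_real"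

instance
  by standard (auto simp: to_complex_real_def Reals_def scaleR_conv_of_real)

end

instantiation complex :: real_or_complex_field
begin

definition to_complex_complex :: "complex \<Rightarrow> complex" where
  "to_complex_complex z = z"

instance
  by standard (auto simp: to_complex_complex_def)

end

text \<open>
  A Hilbert space over the scalar field. The norm, and the completeness with respect to it, are
  those of the class \<^class>\<open>banach\<close>; the axiom \<open>ip_norm\<close> says that this norm is the one
  induced by the inner product (and so contains positive definiteness). The inner product is linear
  in its first argument.
\<close>

locale hilbert_space = vector_space scl
  for scl :: "'k::real_or_complex_field \<Rightarrow> 'h::banach \<Rightarrow> 'h" +
  fixes ip :: "'h \<Rightarrow> 'h \<Rightarrow> 'k"
  assumes scale_of_real: "scl (of_real r) x = r *\<^sub>R x"
    and ip_add: "ip (x + y) z = ip x z + ip y z"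
    and ip_scale: "ip (scl a x) z = a * ip x z"
    and ip_cnj: "to_complex (ip y x) = cnj (to_complex (ip x y))"
    and ip_norm: "ip x x = of_real ((norm x)\<^sup>2)"

lemma hilbert_space_real:
  "hilbert_space (scaleR :: real \<Rightarrow> 'h::{real_inner,banach} \<Rightarrow> 'h) inner"
  by unfold_locales
    (auto simp: to_complex_real_def inner_add_left inner_commute power2_norm_eq_inner algebra_simps)

lemma hilbert_space_complex: "hilbert_space ((*) :: complex \<Rightarrow> _) (\<lambda>z w. z * cnj w)"
  by unfold_locales
    (auto simp: to_complex_complex_def scaleR_conv_of_real complex_norm_square[symmetric] algebra_simps)

definition unitary ::
  "('k::field \<Rightarrow> 'h::ab_group_add \<Rightarrow> 'h) \<Rightarrow> ('h \<Rightarrow> 'h \<Rightarrow> 'k) \<Rightarrow> ('h \<Rightarrow> 'h) \<Rightarrow> bool" where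
  "unitary scl ip T \<longleftrightarrow>
     Vector_Spaces.linear scl scl T \<and> surj T \<and> (\<forall>x y. ip (T x) (T y) = ip x y)"

definition findim_subspace :: "('k::field \<Rightarrow> 'h::ab_group_add \<Rightarrow> 'h) \<Rightarrow> 'h set \<Rightarrow> bool" where
  "findim_subspace scl E \<longleftrightarrow>
     module.subspace scl E \<and> (\<exists>B. finite B \<and> E = module.span scl B)"

text \<open>
  A linear operator from a subspace to itself is a function on the whole type of which only the
  values on the subspace matter.
\<close>

definition linear_operator_on ::
  "('k::field \<Rightarrow> 'h::ab_group_add \<Rightarrow> 'h) \<Rightarrow> 'h set \<Rightarrow> ('h \<Rightarrow> 'h) \<Rightarrow> bool" where
  "linear_operator_on scl E S \<longleftrightarrow>
     (\<forall>x\<in>E. S x \<in> E) \<and>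
     (\<forall>x\<in>E. \<forall>y\<in>E. S (x + y) = S x + S y) \<and>
     (\<forall>a. \<forall>x\<in>E. S (scl a x) = scl a (S x))"

text \<open>For finite \<open>\<omega>\<close> and \<open>\<delta> > 0\<close> the minimum exists, since \<open>span \<omega>\<close> is admissible.\<close>

definition H_apr :: "('k::field \<Rightarrow> 'h::real_normed_vector \<Rightarrow> 'h) \<Rightarrow> 'h set \<Rightarrow> real \<Rightarrow> nat" where
  "H_apr scl \<omega> \<delta> =
     (LEAST d. \<exists>E. findim_subspace scl E \<and> vector_space.dim scl E = d \<and>
        (\<forall>x\<in>\<omega>. \<exists>y\<in>E. norm (x - y) < \<delta>))"

definition h_apr_at ::
  "('k::field \<Rightarrow> 'h::real_normed_vector \<Rightarrow> 'h) \<Rightarrow> ('h \<Rightarrow> 'h) \<Rightarrow> 'h set \<Rightarrow> real \<Rightarrow> real" where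
  "h_apr_at scl T \<omega> \<delta> =
     lim (\<lambda>n. 1 / real n * real (H_apr scl (\<Union>k<n. (T ^^ k) ` \<omega>) \<delta>))"

definition h_apr_fin ::
  "('k::field \<Rightarrow> 'h::real_normed_vector \<Rightarrow> 'h) \<Rightarrow> ('h \<Rightarrow> 'h) \<Rightarrow> 'h set \<Rightarrow> ereal" where
  "h_apr_fin scl T \<omega> = (SUP \<delta>\<in>{0<..}. ereal (h_apr_at scl T \<omega> \<delta>))"

text \<open>Extended real, since the supremum may be infinite for an infinite-dimensional \<open>F\<close>.\<close>

definition h_apr ::
  "('k::field \<Rightarrow> 'h::real_normed_vector \<Rightarrow> 'h) \<Rightarrow> ('h \<Rightarrow> 'h) \<Rightarrow> 'h set \<Rightarrow> ereal" where
  "h_apr scl T F = (SUP \<omega>\<in>{\<omega>. finite \<omega> \<and> \<omega> \<subseteq> F}. h_apr_fin scl T \<omega>)"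

definition orbit_span ::
  "('k::field \<Rightarrow> 'h::ab_group_add \<Rightarrow> 'h) \<Rightarrow> ('h \<Rightarrow> 'h) \<Rightarrow> 'h set \<Rightarrow> nat \<Rightarrow> 'h set" where
  "orbit_span scl T F n = module.span scl (\<Union>k\<le>n. (T ^^ k) ` F)"

end

theory Submission imports Defs begin

text \<open>
  If \<open>T'\<close> is close to \<open>T\<close> on \<open>F\<^sub>n\<close> for the first \<open>K\<close> powers, then \<open>F\<^sub>n\<close> itself approximates
  \<open>\<Union>k<K. T\<^sup>k \<omega>\<close> for every finite \<open>\<omega> \<subseteq> F\<close>, so its dimension is at least the approximation number
  of that set. The approximation numbers are subadditive along orbits because \<open>T\<close> is isometric, so
  by Fekete's lemma the limit defining the entropy is an infimum and bounds every single term from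
  below.
\<close>

section \<open>Fekete's lemma for nonnegative subadditive sequences\<close>

text \<open>Fix \<open>m\<close> whose ratio is close to the infimum and divide \<open>n\<close> by
  \<open>m\<close> with remainder: the remainder contributes a bounded amount, which vanishes after
  division by \<open>n\<close>. Nonnegativity keeps the infimum finite.\<close>

lemma fekete_Inf:
  fixes u :: "nat \<Rightarrow> real"
  assumes nonneg: "\<And>n. 0 \<le> u n" and sub: "\<And>m n. u (m + n) \<le> u m + u n"
  shows "(\<lambda>n. u n / real n) \<longlonglongrightarrow> (INF n\<in>{1..}. u n / real n)"
proof -
  define L where "L = (INF n\<in>{1..}. u n / real n)"
  have bdd: "bdd_below ((\<lambda>n. u n / real n) ` {1..})"
    by (rule bdd_belowI[of _ 0]) (auto simp: nonneg)
  have L_le: "L \<le> u n / real n" if "n \<ge> 1" for n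
    unfolding L_def using that by (intro cINF_lower bdd) auto
  have mult: "u (q * m + r) \<le> real q * u m + u r" for q m r
  proof (induction q)
    case (Suc q)
    have "u (Suc q * m + r) \<le> u m + u (q * m + r)"
      using sub[of m "q * m + r"] by (simp add: add.assoc)
    then show ?case using Suc by (simp add: algebra_simps)
  qed simp
  have "\<forall>\<^sub>F n in sequentially. dist (u n / real n) L < e" if "e > 0" for e
  proof -
    have "\<exists>x\<in>(\<lambda>n. u n / real n) ` {1..}. x < L + e"
      using \<open>e > 0\<close> bdd by (subst cInf_less_iff[symmetric]) (auto simp: L_def)
    then obtain m where m: "m \<ge> 1" "u m / real m < L + e" by auto
    \<comment> \<open>\<open>C\<close> bounds \<open>u\<close> at every possible remainder
      \<open>n mod m\<close>, including 0, since \<open>u 0\<close> may be positive.\<close>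
    define C where "C = Max (u ` {..<m})"
    have upper: "u n / real n \<le> u m / real m + C * (1 / real n)" if "n \<ge> 1" for n
    proof -
      have "u n \<le> real (n div m) * u m + u (n mod m)"
        using mult[of "n div m" m "n mod m"] by simp
      also have "u (n mod m) \<le> C"
        unfolding C_def using m by (intro Max_ge) auto
      also have "real (n div m) * u m \<le> (real n / real m) * u m"
        by (intro mult_right_mono nonneg of_nat_div_le_of_nat)
      finally have "u n \<le> real n * (u m / real m) + C" by (simp add: mult.commute)
      then have "u n / real n \<le> (real n * (u m / real m) + C) / real n"
        by (rule divide_right_mono) simp
      then show ?thesis using that by (simp add: add_divide_distrib)
    qed
    have "(\<lambda>n. u m / real m + C * (1 / real n)) \<longlonglongrightarrow> u m / real m + C * 0"
      by (intro tendsto_intros lim_1_over_n)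
    then have "\<forall>\<^sub>F n in sequentially. u m / real m + C * (1 / real n) < L + e"
      using m by (intro order_tendstoD) auto
    with eventually_ge_at_top[of 1] show ?thesis
    proof eventually_elim
      case (elim n)
      then show ?case using upper[of n] L_le[of n] by (auto simp: dist_real_def)
    qed
  qed
  then show ?thesis unfolding L_def[symmetric] by (rule tendstoI)
qed

text \<open>The form in which Fekete's lemma is applied: the limit bounds each single term from
  below.\<close>

corollary fekete:
  fixes u :: "nat \<Rightarrow> real"
  assumes "\<And>n. 0 \<le> u n" and "\<And>m n. u (m + n) \<le> u m + u n" and "k \<ge> 1"
  shows "lim (\<lambda>n. u n / real n) \<le> u k / real k"
proof -
  have "lim (\<lambda>n. u n / real n) = (INF n\<in>{1..}. u n / real n)"
    using fekete_Inf[OF assms(1,2)] by (rule limI)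
  also have "\<dots> \<le> u k / real k"
  proof (rule cINF_lower)
    show "bdd_below ((\<lambda>n. u n / real n) ` {1..})"
      by (rule bdd_belowI[of _ 0]) (auto simp: assms(1))
  qed (use assms(3) in simp)
  finally show ?thesis .
qed

section \<open>Finite-dimensional subspaces and orbit spans\<close>

context vector_space
begin

lemma findim_subspace_span: "finite B \<Longrightarrow> findim_subspace scale (span B)"
  unfolding findim_subspace_def by auto

text \<open>Lets dimensions be estimated by counting generators. The basis is finite because an
  independent set inside the span of a finite set is finite.\<close>

lemma findim_subspace_basis:
  assumes "findim_subspace scale E"
  obtains B where "finite B" "span B = E" "card B = dim E"
proof -
  obtain W where W: "finite W" "E = span W" and E: "subspace E"
    using assms unfolding findim_subspace_def by auto
  obtain B where B: "B \<subseteq> E" "independent B" "E \<subseteq> span B" "card B = dim E"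
    using basis_exists .
  show ?thesis
  proof
    show "finite B" using independent_span_bound[of W B] W B by auto
    show "span B = E" using B span_minimal[OF B(1) E] by auto
  qed (rule B(4))
qed

text \<open>The images of a finite basis of \<open>F\<close> under \<open>T^0\<close>, ...,
  \<open>T^n\<close> generate the orbit span. This makes it an admissible competitor in
  \<open>H_apr\<close>.\<close>

lemma findim_subspace_orbit_span:
  assumes T: "Vector_Spaces.linear scale scale T" and F: "findim_subspace scale F"
  shows "findim_subspace scale (orbit_span scale T F n)"
proof -
  obtain B where B: "finite B" "span B = F" using F by (rule findim_subspace_basis)
  have lin: "Vector_Spaces.linear scale scale (T ^^ k)" for k
  proof (induction k)
    case 0
    show ?case using linear_id by (simp add: id_def)
  next
    case (Suc k)
    then show ?case using Vector_Spaces.linear_compose[OF Suc T] by (simp add: comp_def)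
  qed
  have "(T ^^ k) ` F = span ((T ^^ k) ` B)" for k
    using lin[of k] B(2) by (metis linear_iff_module_hom module_hom.span_image)
  then have "orbit_span scale T F n = span (\<Union>k\<le>n. span ((T ^^ k) ` B))"
    unfolding orbit_span_def by simp
  also have "\<dots> = span (\<Union>k\<le>n. (T ^^ k) ` B)"
  proof
    show "span (\<Union>k\<le>n. span ((T ^^ k) ` B)) \<subseteq> span (\<Union>k\<le>n. (T ^^ k) ` B)"
      by (intro span_minimal UN_least span_mono subspace_span) auto
    show "span (\<Union>k\<le>n. (T ^^ k) ` B) \<subseteq> span (\<Union>k\<le>n. span ((T ^^ k) ` B))"
      by (intro span_mono UN_mono span_superset) auto
  qed
  finally show ?thesis using B(1) by (auto intro: findim_subspace_span)
qed

end

section \<open>Approximation numbers and their growth along orbits\<close>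

context hilbert_space
begin

lemma H_apr_le_dim:
  assumes "findim_subspace scl E" "\<And>x. x \<in> \<omega> \<Longrightarrow> \<exists>y\<in>E. norm (x - y) < \<delta>"
  shows "H_apr scl \<omega> \<delta> \<le> dim E"
  unfolding H_apr_def using assms by (intro Least_le) auto

text \<open>Generators may be dependent here, so unions and images of bases can be used
  directly.\<close>

lemma H_apr_le_card:
  assumes "finite B" "\<And>x. x \<in> \<omega> \<Longrightarrow> \<exists>y\<in>span B. norm (x - y) < \<delta>"
  shows "H_apr scl \<omega> \<delta> \<le> card B"
  using H_apr_le_dim[OF findim_subspace_span[OF assms(1)] assms(2)] dim_le_card[of "span B" B] assms(1)
  by force

text \<open>The minimum is attained because \<open>span \<omega>\<close> is admissible: each point
  approximates itself with error 0.\<close>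

lemma H_apr_witness:
  assumes "finite \<omega>" "\<delta> > 0"
  obtains B where "finite B" "card B = H_apr scl \<omega> \<delta>" "\<And>x. x \<in> \<omega> \<Longrightarrow> \<exists>y\<in>span B. norm (x - y) < \<delta>"
proof -
  have "\<exists>E. findim_subspace scl E \<and> dim E = dim (span \<omega>) \<and> (\<forall>x\<in>\<omega>. \<exists>y\<in>E. norm (x - y) < \<delta>)"
    using assms by (intro exI[of _ "span \<omega>"]) (auto intro!: findim_subspace_span bexI[OF _ span_base])
  then have "\<exists>E. findim_subspace scl E \<and> dim E = H_apr scl \<omega> \<delta> \<and> (\<forall>x\<in>\<omega>. \<exists>y\<in>E. norm (x - y) < \<delta>)"
    unfolding H_apr_def by (rule LeastI)
  then obtain E where E: "findim_subspace scl E" "dim E = H_apr scl \<omega> \<delta>"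
      "\<forall>x\<in>\<omega>. \<exists>y\<in>E. norm (x - y) < \<delta>" by blast
  obtain B where "finite B" "span B = E" "card B = dim E"
    using E(1) by (rule findim_subspace_basis)
  then show ?thesis using E that by simp
qed

text \<open>The sum of two optimal subspaces, generated by the union of their bases, serves both
  sets.\<close>

lemma H_apr_Un:
  assumes "finite \<omega>" "finite \<omega>'" "\<delta> > 0"
  shows "H_apr scl (\<omega> \<union> \<omega>') \<delta> \<le> H_apr scl \<omega> \<delta> + H_apr scl \<omega>' \<delta>"
proof -
  obtain B where B: "finite B" "card B = H_apr scl \<omega> \<delta>"
      "\<And>x. x \<in> \<omega> \<Longrightarrow> \<exists>y\<in>span B. norm (x - y) < \<delta>"
    using H_apr_witness[OF assms(1,3)] by blast
  obtain B' where B': "finite B'" "card B' = H_apr scl \<omega>' \<delta>"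
      "\<And>x. x \<in> \<omega>' \<Longrightarrow> \<exists>y\<in>span B'. norm (x - y) < \<delta>"
    using H_apr_witness[OF assms(2,3)] by blast
  have "span B \<subseteq> span (B \<union> B')" "span B' \<subseteq> span (B \<union> B')"
    by (simp_all add: span_mono)
  then have "H_apr scl (\<omega> \<union> \<omega>') \<delta> \<le> card (B \<union> B')"
    using B B' by (intro H_apr_le_card) (auto, blast+)
  also have "\<dots> \<le> card B + card B'" by (rule card_Un_le)
  finally show ?thesis using B B' by simp
qed

lemma unitary_norm:
  assumes "unitary scl ip T"
  shows "norm (T x) = norm x"
proof -
  have "(of_real ((norm (T x))\<^sup>2) :: 'k) = of_real ((norm x)\<^sup>2)"
    using assms unfolding unitary_def ip_norm[symmetric] by blast
  then have "(norm (T x))\<^sup>2 = (norm x)\<^sup>2" by (rule of_real_eq_iff[THEN iffD1])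
  then show ?thesis by simp
qed

text \<open>As \<open>T\<close> is a linear isometry, it carries an optimal subspace to one that
  approximates the image with the same errors.\<close>

lemma H_apr_image:
  assumes T: "unitary scl ip T" and "finite \<omega>" "\<delta> > 0"
  shows "H_apr scl (T ` \<omega>) \<delta> \<le> H_apr scl \<omega> \<delta>"
proof -
  have lin: "module_hom scl scl T"
    using T unfolding unitary_def linear_iff_module_hom by blast
  obtain B where B: "finite B" "card B = H_apr scl \<omega> \<delta>"
      "\<And>x. x \<in> \<omega> \<Longrightarrow> \<exists>y\<in>span B. norm (x - y) < \<delta>"
    using H_apr_witness[OF assms(2,3)] by blast
  have "H_apr scl (T ` \<omega>) \<delta> \<le> card (T ` B)"
  proof (rule H_apr_le_card)
    fix z assume "z \<in> T ` \<omega>"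
    then obtain x where x: "x \<in> \<omega>" "z = T x" by auto
    then obtain y where y: "y \<in> span B" "norm (x - y) < \<delta>" using B(3) by auto
    have "norm (z - T y) = norm (x - y)"
      using unitary_norm[OF T, of "x - y"] module_hom.diff[OF lin] x by simp
    then show "\<exists>y\<in>span (T ` B). norm (z - y) < \<delta>"
      using y module_hom.span_image[OF lin, of B] by (metis imageI)
  qed (use B in simp)
  also have "\<dots> \<le> card B" using B(1) by (rule card_image_le)
  finally show ?thesis using B by simp
qed

lemma H_apr_image_funpow:
  assumes T: "unitary scl ip T" and "finite \<omega>" "\<delta> > 0"
  shows "H_apr scl ((T ^^ k) ` \<omega>) \<delta> \<le> H_apr scl \<omega> \<delta>"
proof (induction k)
  case (Suc k)
  have "H_apr scl (T ` (T ^^ k) ` \<omega>) \<delta> \<le> H_apr scl ((T ^^ k) ` \<omega>) \<delta>"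
    using assms by (intro H_apr_image) auto
  with Suc show ?case by (simp add: image_comp)
qed simp

text \<open>The orbit segment of length \<open>m + n\<close> is the segment of length
  \<open>m\<close> together with the image under \<open>T^m\<close> of the segment of length
  \<open>n\<close>.\<close>

lemma H_apr_orbit_subadditive:
  assumes T: "unitary scl ip T" and "finite \<omega>" "\<delta> > 0"
  shows "H_apr scl (\<Union>k<m + n. (T ^^ k) ` \<omega>) \<delta>
    \<le> H_apr scl (\<Union>k<m. (T ^^ k) ` \<omega>) \<delta> + H_apr scl (\<Union>k<n. (T ^^ k) ` \<omega>) \<delta>"
proof -
  have "{..<m + n} = {..<m} \<union> (+) m ` {..<n}"
    by (simp add: lessThan_atLeast0 ivl_disj_un add.commute)
  then have split: "(\<Union>k<m + n. (T ^^ k) ` \<omega>)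
      = (\<Union>k<m. (T ^^ k) ` \<omega>) \<union> (T ^^ m) ` (\<Union>k<n. (T ^^ k) ` \<omega>)"
    by (simp add: UN_Un image_UN image_comp funpow_add)
  have "H_apr scl ((T ^^ m) ` (\<Union>k<n. (T ^^ k) ` \<omega>)) \<delta> \<le> H_apr scl (\<Union>k<n. (T ^^ k) ` \<omega>) \<delta>"
    using assms by (intro H_apr_image_funpow) auto
  moreover have "H_apr scl (\<Union>k<m + n. (T ^^ k) ` \<omega>) \<delta>
      \<le> H_apr scl (\<Union>k<m. (T ^^ k) ` \<omega>) \<delta> + H_apr scl ((T ^^ m) ` (\<Union>k<n. (T ^^ k) ` \<omega>)) \<delta>"
    unfolding split using assms by (intro H_apr_Un) auto
  ultimately show ?thesis by linarith
qed

lemma h_apr_at_le: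
  assumes "unitary scl ip T" "finite \<omega>" "\<delta> > 0" "k \<ge> 1"
  shows "h_apr_at scl T \<omega> \<delta> \<le> real (H_apr scl (\<Union>i<k. (T ^^ i) ` \<omega>) \<delta>) / real k"
  using fekete[of "\<lambda>n. real (H_apr scl (\<Union>i<n. (T ^^ i) ` \<omega>) \<delta>)", OF _ _ assms(4)]
    H_apr_orbit_subadditive[OF assms(1-3)]
  by (simp add: h_apr_at_def flip: of_nat_add)

text \<open>Rules out infinite entropy, so that subtracting \<open>\<epsilon>\<close> really
  decreases it. Fekete's bound at index 1 involves only \<open>\<omega>\<close>, for which
  \<open>F\<close> is admissible.\<close>

lemma h_apr_le_dim:
  assumes "unitary scl ip T" "findim_subspace scl F"
  shows "h_apr scl T F \<le> ereal (real (dim F))"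
  unfolding h_apr_def h_apr_fin_def
proof (intro SUP_least)
  fix \<omega> and \<delta> :: real assume *: "\<omega> \<in> {\<omega>. finite \<omega> \<and> \<omega> \<subseteq> F}" "\<delta> \<in> {0<..}"
  have "h_apr_at scl T \<omega> \<delta> \<le> real (H_apr scl \<omega> \<delta>)"
    using h_apr_at_le[OF assms(1), of \<omega> \<delta> 1] * by (simp add: lessThan_Suc)
  also have "H_apr scl \<omega> \<delta> \<le> dim F"
    using assms(2) * by (intro H_apr_le_dim) (auto intro: rev_bexI)
  finally show "ereal (h_apr_at scl T \<omega> \<delta>) \<le> ereal (real (dim F))" by simp
qed

end

theorem theorem3p4:
  fixes scl :: "'k::real_or_complex_field \<Rightarrow> 'h::banach \<Rightarrow> 'h"
    and ip :: "'h \<Rightarrow> 'h \<Rightarrow> 'k"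
    and T :: "'h \<Rightarrow> 'h"
    and F :: "'h set"
    and \<epsilon> :: real
  assumes "hilbert_space scl ip"
    and "unitary scl ip T"
    and "findim_subspace scl F"
    and "\<epsilon> > 0"
  shows "\<exists>(K\<^sub>0::nat) (\<delta>::real). \<delta> > 0 \<and>
    (\<forall>(n::nat) (K::nat) (T' :: 'h \<Rightarrow> 'h).
       K \<ge> K\<^sub>0 \<and>
       linear_operator_on scl (orbit_span scl T F n) T' \<and>
       (\<forall>x\<in>orbit_span scl T F n. \<forall>k<K. norm ((T' ^^ k) x - (T ^^ k) x) \<le> \<delta> * norm x) \<longrightarrow>
       ereal (real (vector_space.dim scl (orbit_span scl T F n)))
         \<ge> ereal (real K) * (h_apr scl T F - ereal \<epsilon>))"
proof -
  interpret hilbert_space scl ip by fact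
  have T: "Vector_Spaces.linear scl scl T" using assms(2) unfolding unitary_def by blast
  \<comment> \<open>The empty set excludes the value minus infinity, so the entropy is a real
    number.\<close>
  have "ereal (h_apr_at scl T {} 1) \<le> h_apr scl T F"
    unfolding h_apr_def h_apr_fin_def by (intro SUP_upper2[of "{}"] SUP_upper2[of 1]) auto
  then have "h_apr scl T F - ereal \<epsilon> < h_apr scl T F"
    using h_apr_le_dim[OF assms(2,3)] \<open>\<epsilon> > 0\<close> by (cases "h_apr scl T F") auto
  then obtain \<omega> \<delta> where \<omega>: "finite \<omega>" "\<omega> \<subseteq> F" and \<delta>: "\<delta> > 0"
    and less: "h_apr scl T F - ereal \<epsilon> < ereal (h_apr_at scl T \<omega> \<delta>)"
    unfolding h_apr_def h_apr_fin_def by (auto simp: less_SUP_iff)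
  define M where "M = (\<Sum>x\<in>\<omega>. norm x)"
  have M: "M \<ge> 0" "\<And>x. x \<in> \<omega> \<Longrightarrow> norm x \<le> M"
    unfolding M_def using \<omega>(1) by (auto intro: sum_nonneg member_le_sum)
  \<comment> \<open>This is the tolerance required by the theorem; it is fixed before
    \<open>n\<close> and \<open>K\<close>. The summand 1 avoids division by zero and makes
    \<open>\<eta> * norm x < \<delta>\<close> strict.\<close>
  define \<eta> where "\<eta> = \<delta> / (M + 1)"
  have "\<eta> > 0" using \<delta> M by (simp add: \<eta>_def)
  have close: "\<eta> * norm x < \<delta>" if "x \<in> \<omega>" for x
  proof -
    have "\<delta> * norm x < \<delta> * (M + 1)" using M(2)[OF that] \<delta> by simp
    then show ?thesis using M(1) by (simp add: \<eta>_def pos_divide_less_eq)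
  qed
  have bound: "ereal (real K) * (h_apr scl T F - ereal \<epsilon>) \<le> ereal (real (dim (orbit_span scl T F n)))"
    if S: "linear_operator_on scl (orbit_span scl T F n) S"
      and near: "\<forall>x\<in>orbit_span scl T F n. \<forall>k<K. norm ((S ^^ k) x - (T ^^ k) x) \<le> \<eta> * norm x"
    for n K S
  proof (cases "K = 0")
    case False
    let ?G = "orbit_span scl T F n"
    \<comment> \<open>The term \<open>k = 0\<close> of the union is \<open>F\<close> itself.\<close>
    have "F \<subseteq> (\<Union>k\<le>n. (T ^^ k) ` F)" by force
    then have FG: "F \<subseteq> ?G" unfolding orbit_span_def using span_superset by blast
    have S_in: "(S ^^ k) x \<in> ?G" if "x \<in> ?G" for k x
      using that S by (induction k) (auto simp: linear_operator_on_def)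
    have H: "H_apr scl (\<Union>k<K. (T ^^ k) ` \<omega>) \<delta> \<le> dim ?G"
    proof (rule H_apr_le_dim)
      show "findim_subspace scl ?G" using T assms(3) by (rule findim_subspace_orbit_span)
      fix z assume "z \<in> (\<Union>k<K. (T ^^ k) ` \<omega>)"
      then obtain k x where kx: "k < K" "x \<in> \<omega>" "z = (T ^^ k) x" by auto
      then have x: "x \<in> ?G" using \<omega>(2) FG by auto
      \<comment> \<open>The approximant of \<open>T^k x\<close> is \<open>S^k x\<close>, which stays
        in \<open>?G\<close> because \<open>S\<close> maps \<open>?G\<close> to itself.\<close>
      have "norm (z - (S ^^ k) x) \<le> \<eta> * norm x"
        using near x kx by (simp add: norm_minus_commute)
      also have "\<dots> < \<delta>" using close kx by simp
      finally show "\<exists>y\<in>?G. norm (z - y) < \<delta>" using S_in[OF x] by blast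
    qed
    have "ereal (real K) * (h_apr scl T F - ereal \<epsilon>) \<le> ereal (real K) * ereal (h_apr_at scl T \<omega> \<delta>)"
      using less by (intro ereal_mult_left_mono) auto
    also have "real K * h_apr_at scl T \<omega> \<delta> \<le> real (H_apr scl (\<Union>k<K. (T ^^ k) ` \<omega>) \<delta>)"
      using h_apr_at_le[OF assms(2) \<omega>(1) \<delta>, of K] False by (simp add: field_simps)
    then have "ereal (real K) * ereal (h_apr_at scl T \<omega> \<delta>) \<le> ereal (real (dim ?G))"
      using H by simp
    finally show ?thesis .
  qed (simp add: zero_ereal_def[symmetric])
  show ?thesis
    \<comment> \<open>Fekete's bound holds at every positive index, not only asymptotically, so the
      threshold can be 0.\<close>
    using \<open>\<eta> > 0\<close> bound by (intro exI[of _ 0] exI[of _ \<eta>]) blast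
qed

end
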